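(* Let $\mu$ be a positive measure on the unit circle $\mathbb{T}$, finite and with infinite support, let $\mathfrak{q}\in\mathbb{C}$, and for $t\in\mathbb{R}$ let $\{\mathfrak{a}_n(t)\}_{n=0}^\infty$ be the Verblunsky coefficients associated with the measure $\mu^{(t)}$ given by $d\mu^{(t)}(z)=e^{-t(\overline{\mathfrak{q}}z+\mathfrak{q}/z)}d\mu(z)$. Assume that $\mathfrak{a}_n(t)\ne 0$ for all $n\ge 0$ and all $t$. Then $$\dot{\mathfrak{a}}_n=(1-|\mathfrak{a}_n|^2)\left(\overline{\mathfrak{q}}\,\mathfrak{a}_{n-1}-\mathfrak{q}\,\mathfrak{a}_{n+1}\right),\quad n\ge 1,$$ where the dot denotes $d/dt$.
   Context: The Verblunsky coefficients are $\mathfrak{a}_n(t)=-\overline{\Phi_{n+1}(0;t)}$, $n\ge 0$, where $\Phi_n(z;t)$ is the monic orthogonal polynomial of degree $n$ on the unit circle with respect to $\mu^{(t)}$, i.e. $\int_{\mathbb{T}}z^{-k}\Phi_n(z;t)\,d\mu^{(t)}(z)=0$ for $k=0,1,\dots,n-1$. *)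

theory Defs
  imports "HOL-Analysis.Analysis" "HOL-Computational_Algebra.Polynomial"
begin

abbreviation unit_circle :: "complex set" where
  "unit_circle \<equiv> sphere 0 1"

definition circle_measure :: "complex measure \<Rightarrow> bool" where
  "circle_measure M \<longleftrightarrow>
     sets M = sets (restrict_space borel unit_circle) \<and> finite_measure M"

definition measure_support :: "'a::topological_space measure \<Rightarrow> 'a set" where
  "measure_support M = {x \<in> space M. \<forall>U. open U \<and> x \<in> U \<longrightarrow> emeasure M (U \<inter> space M) > 0}"

(* If the support of M is infinite there is exactly one such polynomial for every n;
   otherwise the description is unspecified for large n. *)
definition monic_opuc :: "complex measure \<Rightarrow> nat \<Rightarrow> complex poly" where
  "monic_opuc M n =
     (THE p. degree p = n \<and> lead_coeff p = 1 \<and>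
        (\<forall>k<n. (LINT z|M. z powi (- int k) * poly p z) = 0))"

definition verblunsky :: "complex measure \<Rightarrow> nat \<Rightarrow> complex" where
  "verblunsky M n = - cnj (poly (monic_opuc M (n + 1)) 0)"

(* The exponent is real on the unit circle, so Re only converts the type there. *)
lemma tilt_exponent_real:
  fixes z q :: complex
  assumes "z \<in> unit_circle"
  shows "cnj q * z + q / z = of_real (Re (cnj q * z + q / z))"
proof -
  have "cmod z = 1" using assms by simp
  then have "1 / z = cnj z"
    by (metis complex_div_cnj div_by_1 mult_1 of_real_1 one_power2)
  then have "q / z = cnj (cnj q * z)"
    by (metis complex_cnj_cnj complex_cnj_mult mult.right_neutral times_divide_eq_right)
  then show ?thesis
    by (simp add: complex_eq_iff)
qed

definition exp_tilt :: "complex measure \<Rightarrow> complex \<Rightarrow> real \<Rightarrow> complex measure" where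
  "exp_tilt M q t = density M (\<lambda>z. ennreal (exp (- t * Re (cnj q * z + q / z))))"

end

(* Differentiating the orthogonality relations in t shows that the t-derivative of Phi_(m+1), a
   polynomial of degree at most m, is orthogonal to z, ..., z^(m-1), and its inner products with 1
   and z^m are read off the Szego recursion. By nondegeneracy it is the combination of Phi_m and
   its reversed polynomial with the same data, and the constant coefficient is the claim. The Szego
   recursion also gives existence of the derivative: it writes the coefficients of Phi_n rationally
   in the moments, which are differentiable by dominated differentiation under the integral. *)

theory Submission
  imports Defs
begin

section \<open>Continuous functions on the unit circle and their integrals\<close>

lemma space_circle_measure: "circle_measure M \<Longrightarrow> space M = unit_circle"
  unfolding circle_measure_def
  by (metis sets_eq_imp_space_eq space_borel space_restrict_space inf_top.right_neutral)

lemma measurable_circle: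
  fixes f :: "complex \<Rightarrow> 'a::topological_space"
  assumes "circle_measure M" "continuous_on unit_circle f"
  shows "f \<in> borel_measurable M"
  using borel_measurable_continuous_on_restrict[OF assms(2)] assms(1)
  unfolding circle_measure_def by (metis measurable_cong_sets)

lemma bounded_circle:
  fixes f :: "complex \<Rightarrow> 'a::real_normed_vector"
  assumes "continuous_on unit_circle f"
  obtains B where "B \<ge> 0" "\<And>z. z \<in> unit_circle \<Longrightarrow> norm (f z) \<le> B"
proof -
  have "bounded (f ` unit_circle)"
    by (intro compact_imp_bounded compact_continuous_image assms compact_sphere)
  then obtain B where "\<And>z. z \<in> unit_circle \<Longrightarrow> norm (f z) \<le> B"
    unfolding bounded_iff by blast
  then show ?thesis
    by (intro that[of "max B 0"]) (auto simp: le_max_iff_disj)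
qed

lemma integrable_circle:
  fixes f :: "complex \<Rightarrow> 'a::{banach, second_countable_topology}"
  assumes "circle_measure M" "continuous_on unit_circle f"
  shows "integrable M f"
proof -
  obtain B where B: "\<And>z. z \<in> unit_circle \<Longrightarrow> norm (f z) \<le> B"
    using bounded_circle[OF assms(2)] by metis
  interpret finite_measure M
    using assms(1) by (simp add: circle_measure_def)
  show ?thesis
    by (rule integrable_const_bound[where B = B])
      (use B in \<open>auto simp: space_circle_measure[OF assms(1)] intro!: measurable_circle assms\<close>)
qed

lemma unit_circle_cnj:
  assumes "z \<in> unit_circle"
  shows "z \<noteq> 0" "cnj z = inverse z"
proof -
  show "z \<noteq> 0" using assms by auto
  have "z * cnj z = 1"
    using assms by (simp flip: complex_norm_square)
  then show "cnj z = inverse z"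
    by (metis inverse_unique)
qed

section \<open>Inner products of polynomials with powers of z\<close>

text \<open>On the circle \<open>z powi (- k)\<close> is the conjugate of \<open>z powi k\<close>,
  so this is the L2 inner product with z^k. The index is an integer because the Szego recursion
  needs k = -1.\<close>

definition circle_ip :: "complex measure \<Rightarrow> complex poly \<Rightarrow> int \<Rightarrow> complex" where
  "circle_ip M p k = (LINT z|M. z powi (- k) * poly p z)"

lemma continuous_on_powi_poly:
  "continuous_on unit_circle (\<lambda>z::complex. z powi k * poly p z)"
  by (intro continuous_intros) auto

lemma continuous_on_powi_circle: "continuous_on unit_circle (\<lambda>z::complex. z powi k)"
  by (intro continuous_intros) auto

context
  fixes M :: "complex measure"
  assumes circ: "circle_measure M"
begin

lemma circle_ip_diff: "circle_ip M (p - r) k = circle_ip M p k - circle_ip M r k"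
  unfolding circle_ip_def
  by (subst Bochner_Integration.integral_diff[symmetric])
    (auto simp: ring_distribs intro!: integrable_circle[OF circ] continuous_on_powi_poly)

lemma circle_ip_add: "circle_ip M (p + r) k = circle_ip M p k + circle_ip M r k"
  unfolding circle_ip_def
  by (subst Bochner_Integration.integral_add[symmetric])
    (auto simp: ring_distribs intro!: integrable_circle[OF circ] continuous_on_powi_poly)

lemma circle_ip_smult: "circle_ip M (smult c p) k = c * circle_ip M p k"
  unfolding circle_ip_def by (simp add: mult.left_commute)

lemma circle_ip_pCons_0: "circle_ip M (pCons 0 p) k = circle_ip M p (k - 1)"
  unfolding circle_ip_def
proof (rule Bochner_Integration.integral_cong)
  fix z assume "z \<in> space M"
  then have "z \<noteq> 0" using space_circle_measure[OF circ] by auto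
  then show "z powi (- k) * poly (pCons 0 p) z = z powi (- (k - 1)) * poly p z"
    using power_int_add[of z "-k" 1] by (simp add: mult.assoc)
qed simp

text \<open>Separates the coefficients of the polynomial from the moments of the measure, so that
  the two can be differentiated in t independently. The bound \<open>n\<close> may exceed the
  degree, which allows one fixed index range for a whole family of polynomials.\<close>

lemma circle_ip_moments:
  assumes "degree p \<le> n"
  shows "circle_ip M p k = (\<Sum>i\<le>n. coeff p i * (LINT z|M. z powi (int i - k)))"
proof -
  have "circle_ip M p k = (LINT z|M. (\<Sum>i\<le>n. coeff p i * z powi (int i - k)))"
    unfolding circle_ip_def
  proof (rule Bochner_Integration.integral_cong)
    fix z assume "z \<in> space M"
    then have "z \<noteq> 0" using space_circle_measure[OF circ] by auto
    moreover have "poly p z = (\<Sum>i\<le>n. coeff p i * z ^ i)"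
      unfolding poly_altdef
      by (rule sum.mono_neutral_left) (use assms in \<open>auto simp: coeff_eq_0\<close>)
    ultimately show "z powi (- k) * poly p z = (\<Sum>i\<le>n. coeff p i * z powi (int i - k))"
      by (simp add: sum_distrib_left power_int_diff power_int_minus field_simps)
  qed simp
  also have "\<dots> = (\<Sum>i\<le>n. coeff p i * (LINT z|M. z powi (int i - k)))"
    by (subst Bochner_Integration.integral_sum)
      (auto intro!: integrable_mult_right integrable_circle[OF circ, OF continuous_on_powi_circle])
  finally show ?thesis .
qed

end

section \<open>Reversed polynomials\<close>

text \<open>Szego's reversed polynomial, usually written with a star. The reversal is taken at the
  actual degree of \<open>p\<close>, which is n for the monic polynomial Phi_n.\<close>

definition rev_poly :: "complex poly \<Rightarrow> complex poly" where
  "rev_poly p = reflect_poly (map_poly cnj p)"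

lemma degree_map_poly_cnj [simp]: "degree (map_poly cnj p) = degree p"
  by (rule degree_map_poly) auto

lemma coeff_rev_poly:
  "coeff (rev_poly p) i = (if i \<le> degree p then cnj (coeff p (degree p - i)) else 0)"
  by (simp add: rev_poly_def coeff_reflect_poly coeff_map_poly)

lemma degree_rev_poly: "degree (rev_poly p) \<le> degree p"
  using degree_reflect_poly_le[of "map_poly cnj p"] by (simp add: rev_poly_def)

lemma poly_rev_poly:
  assumes "z \<in> unit_circle"
  shows "poly (rev_poly p) z = z ^ degree p * cnj (poly p z)"
proof -
  have "z \<noteq> 0" "cnj (inverse z) = z"
    using unit_circle_cnj[OF assms] by auto
  then show ?thesis
    by (simp add: rev_poly_def poly_reflect_poly_nz)
qed

text \<open>On the circle the reversed polynomial is z^(deg p) times the conjugate of p, so the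
  integrand is the conjugate of the one with index deg p - k.\<close>

lemma circle_ip_rev_poly:
  assumes "circle_measure M"
  shows "circle_ip M (rev_poly p) k = cnj (circle_ip M p (int (degree p) - k))"
  unfolding circle_ip_def Bochner_Integration.integral_cnj[symmetric]
proof (rule Bochner_Integration.integral_cong)
  fix z assume "z \<in> space M"
  then have z: "z \<in> unit_circle" "z \<noteq> 0" "cnj z = inverse z"
    using space_circle_measure[OF assms] unit_circle_cnj by auto
  have "cnj (z powi (- (int (degree p) - k))) = z powi (- k + int (degree p))"
    unfolding complex_cnj_power_int z(3) power_int_inverse power_int_minus[symmetric] by simp
  also have "\<dots> = z powi (- k) * z ^ degree p"
    using z(2) by (simp only: power_int_add power_int_of_nat simp_thms)
  finally show "z powi (- k) * poly (rev_poly p) z = cnj (z powi (- (int (degree p) - k)) * poly p z)"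
    by (simp only: poly_rev_poly[OF z(1)] complex_cnj_mult mult.assoc)
qed simp

section \<open>Nondegenerate measures\<close>

text \<open>Infinite support enters in this form, which depends only on the null sets and therefore
  passes directly to the tilted measures.\<close>

definition nondegenerate :: "complex measure \<Rightarrow> bool" where
  "nondegenerate M \<longleftrightarrow> circle_measure M \<and> (\<forall>p. (AE z in M. poly p z = 0) \<longrightarrow> p = 0)"

lemma nondegenerate_circle: "nondegenerate M \<Longrightarrow> circle_measure M"
  by (simp add: nondegenerate_def)

text \<open>A nonzero polynomial has finitely many roots, so some support point is not a root. The
  non-roots form an open neighbourhood of it, which has positive measure.\<close>

lemma nondegenerate_infinite_support:
  assumes "circle_measure M" "infinite (measure_support M)"
  shows "nondegenerate M"
  unfolding nondegenerate_def
proof (intro conjI allI impI assms(1))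
  fix p :: "complex poly" assume AE: "AE z in M. poly p z = 0"
  show "p = 0"
  proof (rule ccontr)
    assume "p \<noteq> 0"
    then have "finite {z. poly p z = 0}" by (rule poly_roots_finite)
    then obtain x where x: "x \<in> measure_support M" "poly p x \<noteq> 0"
      using assms(2) by (metis (mono_tags, lifting) finite_subset mem_Collect_eq subsetI)
    define U where "U = {z. poly p z \<noteq> 0}"
    have "open U"
      unfolding U_def by (intro open_Collect_neq continuous_intros)
    then have pos: "emeasure M (U \<inter> space M) > 0"
      using x by (auto simp: measure_support_def U_def)
    have "poly p \<in> borel_measurable M"
      by (intro measurable_circle assms continuous_intros)
    then have "{z \<in> space M. poly p z \<noteq> 0} \<in> null_sets M"
      using AE by (subst AE_iff_null[symmetric]) auto
    moreover have "{z \<in> space M. poly p z \<noteq> 0} = U \<inter> space M"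
      by (auto simp: U_def)
    ultimately show False using pos by auto
  qed
qed

text \<open>Summing the conditions with weights \<open>cnj (coeff p k)\<close> yields the integral
  of |p|^2, which is thus zero.\<close>

lemma nondegenerate_orthogonal_imp_0:
  assumes "nondegenerate M" "\<And>k. k \<le> degree p \<Longrightarrow> circle_ip M p (int k) = 0"
  shows "p = 0"
proof -
  have circ: "circle_measure M" using assms(1) by (rule nondegenerate_circle)
  have int: "integrable M (\<lambda>z. (cmod (poly p z))\<^sup>2)"
    by (intro integrable_circle circ continuous_intros)
  have "complex_of_real (LINT z|M. (cmod (poly p z))\<^sup>2)
      = (LINT z|M. (\<Sum>k\<le>degree p. cnj (coeff p k) * (z powi (- int k) * poly p z)))"
    unfolding integral_complex_of_real[symmetric]
  proof (rule Bochner_Integration.integral_cong)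
    fix z assume "z \<in> space M"
    then have z: "z \<noteq> 0" "cnj z = inverse z"
      using space_circle_measure[OF circ] unit_circle_cnj by auto
    have "complex_of_real ((cmod (poly p z))\<^sup>2) = cnj (poly p z) * poly p z"
      unfolding complex_norm_square by (rule mult.commute)
    also have "cnj (poly p z) = (\<Sum>k\<le>degree p. cnj (coeff p k) * z powi (- int k))"
      using z by (simp add: poly_altdef power_int_minus power_inverse)
    finally show "complex_of_real ((cmod (poly p z))\<^sup>2)
        = (\<Sum>k\<le>degree p. cnj (coeff p k) * (z powi (- int k) * poly p z))"
      by (simp add: sum_distrib_right mult.assoc)
  qed simp
  also have "\<dots> = (\<Sum>k\<le>degree p. cnj (coeff p k) * circle_ip M p (int k))"
    unfolding circle_ip_def
    by (subst Bochner_Integration.integral_sum)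
      (auto intro!: integrable_mult_right integrable_circle[OF circ, OF continuous_on_powi_poly])
  also have "\<dots> = 0" using assms(2) by simp
  finally have "(LINT z|M. (cmod (poly p z))\<^sup>2) = 0" by simp
  then have "AE z in M. poly p z = 0"
    by (subst (asm) integral_nonneg_eq_0_iff_AE[OF int]) auto
  then show ?thesis using assms(1) by (simp add: nondegenerate_def)
qed

section \<open>The Szego recursion\<close>

text \<open>The recursion serves as the definition of Phi_n, since it uses only rational operations
  on moments and conjugation; agreement with \<open>monic_opuc\<close> is proved afterwards. The
  quotient is the value that makes the next polynomial orthogonal to 1.\<close>

primrec szego_poly :: "complex measure \<Rightarrow> nat \<Rightarrow> complex poly" where
  "szego_poly M 0 = 1"
| "szego_poly M (Suc n) = pCons 0 (szego_poly M n)
     - smult (circle_ip M (szego_poly M n) (-1) / circle_ip M (szego_poly M n) (int n))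
         (rev_poly (szego_poly M n))"

text \<open>For a nondegenerate measure this is the squared L2 norm of Phi_n, because Phi_n is monic
  and orthogonal to all lower powers.\<close>

definition szego_norm :: "complex measure \<Rightarrow> nat \<Rightarrow> complex" where
  "szego_norm M n = circle_ip M (szego_poly M n) (int n)"

text \<open>For a nondegenerate measure this is the conjugate of the Verblunsky coefficient.\<close>

definition szego_coeff :: "complex measure \<Rightarrow> nat \<Rightarrow> complex" where
  "szego_coeff M n = circle_ip M (szego_poly M n) (-1) / szego_norm M n"

lemma szego_poly_Suc:
  "szego_poly M (Suc n)
     = pCons 0 (szego_poly M n) - smult (szego_coeff M n) (rev_poly (szego_poly M n))"
  by (simp add: szego_coeff_def szego_norm_def)

declare szego_poly.simps(2) [simp del]

lemma szego_poly_monic: "degree (szego_poly M n) = n \<and> coeff (szego_poly M n) n = 1"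
proof (induction n)
  case (Suc n)
  have "coeff (szego_poly M (Suc n)) (Suc n) = 1"
    using Suc by (simp add: szego_poly_Suc coeff_rev_poly)
  moreover have "degree (szego_poly M (Suc n)) \<le> Suc n"
    using Suc by (intro degree_le) (auto simp: szego_poly_Suc coeff_rev_poly coeff_pCons coeff_eq_0 split: nat.split)
  ultimately show ?case using le_degree[of "szego_poly M (Suc n)" "Suc n"] by simp
qed simp

lemma degree_szego_poly [simp]: "degree (szego_poly M n) = n"
  and coeff_szego_poly [simp]: "coeff (szego_poly M n) n = 1"
  using szego_poly_monic by auto

lemma szego_poly_nz [simp]: "szego_poly M n \<noteq> 0"
  using coeff_szego_poly[of M n] by (metis coeff_0 zero_neq_one)

lemma coeff_0_szego_poly_Suc: "coeff (szego_poly M (Suc n)) 0 = - szego_coeff M n"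
  by (simp add: szego_poly_Suc coeff_rev_poly)

context
  fixes M :: "complex measure"
  assumes nondeg: "nondegenerate M"
begin

private lemmas circ = nondegenerate_circle[OF nondeg]

text \<open>The three claims need a joint induction: orthogonality to 1 at the next stage uses that
  the norm is real and nonzero, and the next norm is nonzero because of orthogonality.\<close>

private lemma szego_main:
  "(\<forall>k. 0 \<le> k \<and> k < int n \<longrightarrow> circle_ip M (szego_poly M n) k = 0) \<and> cnj (szego_norm M n) = szego_norm M n
   \<and> szego_norm M n \<noteq> 0"
proof (induction n)
  case 0
  have "szego_norm M 0 \<noteq> 0"
    using nondegenerate_orthogonal_imp_0[OF nondeg, of 1] by (auto simp: szego_norm_def)
  moreover have "cnj (szego_norm M 0) = szego_norm M 0"
    using circle_ip_rev_poly[OF circ, of 1 0]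
    by (simp add: szego_norm_def rev_poly_def)
  ultimately show ?case by auto
next
  case (Suc n)
  have ip: "circle_ip M (szego_poly M (Suc n)) k = circle_ip M (szego_poly M n) (k - 1)
      - szego_coeff M n * cnj (circle_ip M (szego_poly M n) (int n - k))" for k
    by (simp add: szego_poly_Suc circle_ip_diff[OF circ] circle_ip_pCons_0[OF circ]
        circle_ip_smult[OF circ] circle_ip_rev_poly[OF circ])
  \<comment> \<open>For 0 < k \<le> n both k - 1 and n - k lie between 0 and n - 1, so both terms of
    \<open>ip\<close> vanish by induction. Only k = 0 depends on the choice of
    \<open>szego_coeff\<close>.\<close>
  have orth: "circle_ip M (szego_poly M (Suc n)) k = 0" if "0 \<le> k" "k < int (Suc n)" for k
  proof (cases "k = 0")
    case True
    then show ?thesis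
      using Suc by (simp add: ip szego_coeff_def szego_norm_def[symmetric])
  qed (use Suc that in \<open>simp add: ip\<close>)
  have "szego_norm M (Suc n)
      = szego_norm M n - szego_coeff M n * cnj (circle_ip M (szego_poly M n) (-1))"
    by (simp add: szego_norm_def ip)
  also have "circle_ip M (szego_poly M n) (-1) = szego_coeff M n * szego_norm M n"
    using Suc by (simp add: szego_coeff_def)
  finally have "cnj (szego_norm M (Suc n)) = szego_norm M (Suc n)"
    using Suc by (simp add: mult.commute mult.left_commute)
  moreover have "szego_norm M (Suc n) \<noteq> 0"
  proof
    \<comment> \<open>A vanishing norm would make this monic polynomial orthogonal to every power up
      to its own degree.\<close>
    assume 0: "szego_norm M (Suc n) = 0"
    have "szego_poly M (Suc n) = 0"
    proof (rule nondegenerate_orthogonal_imp_0[OF nondeg])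
      fix k assume "k \<le> degree (szego_poly M (Suc n))"
      then show "circle_ip M (szego_poly M (Suc n)) (int k) = 0"
        using orth[of "int k"] 0 by (cases "k = Suc n") (auto simp: szego_norm_def)
    qed
    then show False by simp
  qed
  ultimately show ?case using orth by blast
qed

lemma szego_poly_orthogonal: "0 \<le> k \<Longrightarrow> k < int n \<Longrightarrow> circle_ip M (szego_poly M n) k = 0"
  and cnj_szego_norm: "cnj (szego_norm M n) = szego_norm M n"
  and szego_norm_nz: "szego_norm M n \<noteq> 0"
  using szego_main by blast+

lemma circle_ip_szego_poly_minus_1:
  "circle_ip M (szego_poly M n) (-1) = szego_coeff M n * szego_norm M n"
  by (simp add: szego_coeff_def szego_norm_nz)

text \<open>The classical ratio of consecutive squared norms; it is the source of the factor 1 -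
  |a_n|^2 in the evolution equation.\<close>

lemma szego_norm_Suc:
  "szego_norm M (Suc n) = (1 - (cmod (szego_coeff M n))\<^sup>2) * szego_norm M n"
proof -
  have "szego_norm M (Suc n)
      = szego_norm M n - szego_coeff M n * cnj (circle_ip M (szego_poly M n) (-1))"
    by (simp add: szego_norm_def szego_poly_Suc circle_ip_diff[OF circ] circle_ip_pCons_0[OF circ]
        circle_ip_smult[OF circ] circle_ip_rev_poly[OF circ])
  also have "\<dots> = (1 - szego_coeff M n * cnj (szego_coeff M n)) * szego_norm M n"
    by (simp add: circle_ip_szego_poly_minus_1 cnj_szego_norm algebra_simps)
  finally show ?thesis by (simp only: of_real_diff of_real_1 complex_norm_square)
qed

text \<open>Two monic candidates of degree n differ by a polynomial of smaller degree that is
  orthogonal to all powers up to its degree, hence by 0.\<close>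

lemma monic_opuc_eq_szego_poly: "monic_opuc M n = szego_poly M n"
  unfolding monic_opuc_def circle_ip_def[symmetric]
proof (rule the_equality)
  show "degree (szego_poly M n) = n \<and> lead_coeff (szego_poly M n) = 1
      \<and> (\<forall>k<n. circle_ip M (szego_poly M n) (int k) = 0)"
    by (simp add: szego_poly_orthogonal)
next
  fix p assume p: "degree p = n \<and> lead_coeff p = 1 \<and> (\<forall>k<n. circle_ip M p (int k) = 0)"
  let ?d = "p - szego_poly M n"
  have "?d = 0 \<or> degree ?d < n"
    using p by (intro eq_zero_or_degree_less degree_diff_le) auto
  moreover have "?d = 0" if "degree ?d < n"
    using that p by (intro nondegenerate_orthogonal_imp_0[OF nondeg])
      (simp add: circle_ip_diff[OF circ] szego_poly_orthogonal)
  ultimately have "?d = 0" by blast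
  then show "p = szego_poly M n" by simp
qed

lemma verblunsky_eq: "verblunsky M n = cnj (szego_coeff M n)"
  by (simp add: verblunsky_def monic_opuc_eq_szego_poly poly_0_coeff_0 coeff_0_szego_poly_Suc)

end

section \<open>Exponentially tilted measures\<close>

lemma continuous_on_tilt_exponent:
  "continuous_on unit_circle (\<lambda>z::complex. cnj q * z + q / z)"
  by (intro continuous_intros) auto

lemma continuous_on_exp_tilt:
  "continuous_on unit_circle (\<lambda>z::complex. exp (- t * Re (cnj q * z + q / z)))"
  by (intro continuous_intros continuous_on_tilt_exponent) auto

lemma measurable_exp_tilt:
  "circle_measure M \<Longrightarrow> (\<lambda>z. ennreal (exp (- t * Re (cnj q * z + q / z)))) \<in> borel_measurable M"
  by (rule measurable_compose[OF measurable_circle[OF _ continuous_on_exp_tilt] measurable_ennreal])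

lemma circle_measure_exp_tilt:
  assumes "circle_measure M"
  shows "circle_measure (exp_tilt M q t)"
proof -
  have "emeasure (exp_tilt M q t) (space M)
      = (\<integral>\<^sup>+ z. ennreal (exp (- t * Re (cnj q * z + q / z))) \<partial>M)"
    unfolding exp_tilt_def
    by (subst emeasure_density[OF measurable_exp_tilt[OF assms] sets.top])
      (intro nn_integral_cong, simp)
  also have "\<dots> < \<infinity>"
    using integrable_circle[OF assms continuous_on_exp_tilt]
    by (subst nn_integral_eq_integral) auto
  finally have "finite_measure (exp_tilt M q t)"
    by (intro finite_measureI) (auto simp: exp_tilt_def)
  then show ?thesis using assms by (simp add: circle_measure_def exp_tilt_def)
qed

text \<open>The density is strictly positive, so tilting preserves the null sets.\<close>

lemma nondegenerate_exp_tilt: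
  assumes "nondegenerate M"
  shows "nondegenerate (exp_tilt M q t)"
proof -
  note circ = nondegenerate_circle[OF assms]
  have "(AE z in exp_tilt M q t. P z) \<longleftrightarrow> (AE z in M. P z)" for P
    unfolding exp_tilt_def by (subst AE_density[OF measurable_exp_tilt[OF circ]]) auto
  then show ?thesis
    using assms circle_measure_exp_tilt[OF circ] by (simp add: nondegenerate_def)
qed

lemma integral_exp_tilt:
  fixes f :: "complex \<Rightarrow> complex"
  assumes "circle_measure M" "continuous_on unit_circle f"
  shows "(LINT z|exp_tilt M q t. f z) = (LINT z|M. exp (- t * Re (cnj q * z + q / z)) *\<^sub>R f z)"
  unfolding exp_tilt_def
  by (intro integral_density measurable_circle assms continuous_on_exp_tilt) simp

section \<open>Differentiation under the integral\<close>

lemma has_vector_derivative_quadratic: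
  fixes f :: "real \<Rightarrow> 'a::real_normed_vector"
  assumes "\<And>s. \<bar>s - t\<bar> < 1 \<Longrightarrow> norm (f s - f t - (s - t) *\<^sub>R d) \<le> K * (s - t)\<^sup>2"
  shows "(f has_vector_derivative d) (at t)"
  unfolding has_vector_derivative_def
proof (rule has_derivativeI_sandwich[where e = 1 and H = "\<lambda>s. K * \<bar>s - t\<bar>"])
  fix s assume s: "s \<noteq> t" "dist s t < 1"
  then have "norm (f s - f t - (s - t) *\<^sub>R d) \<le> K * \<bar>s - t\<bar> * \<bar>s - t\<bar>"
    using assms[of s] by (simp add: dist_real_def power2_eq_square mult.assoc)
  then show "norm (f s - f t - (s - t) *\<^sub>R d) / norm (s - t) \<le> K * \<bar>s - t\<bar>"
    using s by (simp add: divide_le_eq)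
next
  have "((\<lambda>s. K * \<bar>s - t\<bar>) \<longlongrightarrow> K * \<bar>t - t\<bar>) (at t)"
    by (intro tendsto_intros)
  then show "((\<lambda>s. K * \<bar>s - t\<bar>) \<longlongrightarrow> 0) (at t)" by simp
qed (auto intro: bounded_linear_scaleR_left)

text \<open>The exponent is bounded on the circle, so for |s - t| < 1 the first-order Taylor error
  of the integrand is dominated by (s - t)^2 times a fixed integrable function.\<close>

lemma has_vector_derivative_exp_tilt:
  fixes f :: "complex \<Rightarrow> complex"
  assumes circ: "circle_measure M" and f: "continuous_on unit_circle f"
  shows "((\<lambda>s. LINT z|exp_tilt M q s. f z) has_vector_derivative
      - (LINT z|exp_tilt M q t. (cnj q * z + q / z) * f z)) (at t)"
proof -
  define w where "w = (\<lambda>z. Re (cnj q * z + q / z))"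
  define e where "e = (\<lambda>s z. exp (- s * w z))"
  have w: "continuous_on unit_circle w"
    unfolding w_def by (intro continuous_intros continuous_on_tilt_exponent) auto
  have e: "continuous_on unit_circle (e s)" for s
    unfolding e_def by (intro continuous_intros w)
  obtain W where W: "W \<ge> 0" "\<And>z. z \<in> unit_circle \<Longrightarrow> norm (w z) \<le> W"
    using bounded_circle[OF w] by metis
  \<comment> \<open>Dominating function, from |exp x - 1 - x| \<le> exp |x| * x^2 at x = -(s - t) w:
    here |x| \<le> W and x^2 \<le> (s - t)^2 W^2.\<close>
  define g where "g = (\<lambda>z. (exp W * (e t z * W\<^sup>2)) * cmod (f z))"
  have g: "integrable M g"
    unfolding g_def by (intro integrable_circle circ continuous_intros e f)
  have "(LINT z|exp_tilt M q t. (cnj q * z + q / z) * f z)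
      = (LINT z|M. e t z *\<^sub>R ((cnj q * z + q / z) * f z))"
    unfolding e_def w_def
    by (intro integral_exp_tilt circ continuous_intros continuous_on_tilt_exponent f) auto
  also have "\<dots> = (LINT z|M. (e t z * w z) *\<^sub>R f z)"
  proof (rule Bochner_Integration.integral_cong)
    fix z assume "z \<in> space M"
    then have "cnj q * z + q / z = of_real (w z)"
      unfolding w_def using space_circle_measure[OF circ] by (intro tilt_exponent_real) simp
    then show "e t z *\<^sub>R ((cnj q * z + q / z) * f z) = (e t z * w z) *\<^sub>R f z"
      by (simp add: scaleR_conv_of_real)
  qed simp
  finally have deriv: "(LINT z|exp_tilt M q t. (cnj q * z + q / z) * f z)
      = (LINT z|M. (e t z * w z) *\<^sub>R f z)" .
  have val: "(LINT z|exp_tilt M q s. f z) = (LINT z|M. e s z *\<^sub>R f z)" for s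
    unfolding e_def w_def by (intro integral_exp_tilt circ f)
  show ?thesis
    unfolding deriv val
  proof (rule has_vector_derivative_quadratic)
    fix s :: real assume s: "\<bar>s - t\<bar> < 1"
    define x where "x = (\<lambda>z. - (s - t) * w z)"
    \<comment> \<open>Since \<open>e s z = e t z * exp (x z)\<close>, the error of the linear
      approximation is the exponential remainder at \<open>x z\<close>, scaled by
      \<open>e t z\<close>.\<close>
    have ptw: "e s z *\<^sub>R f z - e t z *\<^sub>R f z + (s - t) *\<^sub>R ((e t z * w z) *\<^sub>R f z)
        = (e t z * (exp (x z) - (1 + x z))) *\<^sub>R f z" for z
    proof -
      have "e s z = e t z * exp (x z)"
        by (simp add: e_def x_def exp_add[symmetric] algebra_simps)
      then show ?thesis by (simp add: x_def algebra_simps)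
    qed
    have "(LINT z|M. e s z *\<^sub>R f z) - (LINT z|M. e t z *\<^sub>R f z)
          - (s - t) *\<^sub>R - (LINT z|M. (e t z * w z) *\<^sub>R f z)
        = (LINT z|M. e s z *\<^sub>R f z - e t z *\<^sub>R f z + (s - t) *\<^sub>R ((e t z * w z) *\<^sub>R f z))"
      by (subst Bochner_Integration.integral_add Bochner_Integration.integral_diff
            | intro integrable_circle circ continuous_intros e w f
            | simp only: integral_scaleR_right scaleR_minus_right diff_minus_eq_add)+
    also have "norm \<dots> \<le> (LINT z|M. (s - t)\<^sup>2 * g z)"
    proof (rule Bochner_Integration.integral_norm_bound_integral)
      show "integrable M (\<lambda>z. (s - t)\<^sup>2 * g z)" using g by simp
      show "integrable M (\<lambda>z. e s z *\<^sub>R f z - e t z *\<^sub>R f z + (s - t) *\<^sub>R ((e t z * w z) *\<^sub>R f z))"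
        by (intro integrable_circle circ continuous_intros e w f)
      fix z assume "z \<in> space M"
      then have wz: "\<bar>w z\<bar> \<le> W" using W space_circle_measure[OF circ] by simp
      have x: "\<bar>x z\<bar> \<le> W" "\<bar>x z\<bar> \<le> \<bar>s - t\<bar> * W"
        using s wz mult_mono[of "\<bar>s - t\<bar>" 1 "\<bar>w z\<bar>" W] mult_left_mono[OF wz, of "\<bar>s - t\<bar>"]
        by (auto simp: x_def abs_mult abs_minus_commute)
      have "\<bar>exp (x z) - (1 + x z)\<bar> \<le> exp \<bar>x z\<bar> * \<bar>x z\<bar>\<^sup>2"
        using Taylor_exp_field[of "x z" 1] by (simp add: numeral_2_eq_2 add.commute)
      also have "\<dots> \<le> exp W * (\<bar>s - t\<bar> * W)\<^sup>2"
        using x by (intro mult_mono power_mono) auto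
      finally have "\<bar>exp (x z) - (1 + x z)\<bar> \<le> exp W * ((s - t)\<^sup>2 * W\<^sup>2)"
        by (simp add: power_mult_distrib)
      then have "e t z * \<bar>exp (x z) - (1 + x z)\<bar> * cmod (f z)
          \<le> e t z * (exp W * ((s - t)\<^sup>2 * W\<^sup>2)) * cmod (f z)"
        by (intro mult_right_mono mult_left_mono) (auto simp: e_def)
      then show "norm (e s z *\<^sub>R f z - e t z *\<^sub>R f z + (s - t) *\<^sub>R ((e t z * w z) *\<^sub>R f z))
          \<le> (s - t)\<^sup>2 * g z"
        unfolding ptw by (simp add: g_def abs_mult e_def mult_ac)
    qed
    finally show "norm ((LINT z|M. e s z *\<^sub>R f z) - (LINT z|M. e t z *\<^sub>R f z)
          - (s - t) *\<^sub>R - (LINT z|M. (e t z * w z) *\<^sub>R f z)) \<le> (LINT z|M. g z) * (s - t)\<^sup>2"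
      by (simp add: mult.commute)
  qed
qed

lemma has_vector_derivative_const_imp_0:
  "((\<lambda>s. c) has_vector_derivative d) (at t) \<Longrightarrow> d = 0"
  by (rule vector_derivative_unique_at[OF _ has_vector_derivative_const])

section \<open>Polynomials depending differentiably on t\<close>

text \<open>The derivative is itself a polynomial, so that it can be tested against powers of z by
  \<open>circle_ip\<close>.\<close>

definition poly_has_derivative :: "(real \<Rightarrow> complex poly) \<Rightarrow> complex poly \<Rightarrow> real \<Rightarrow> bool" where
  "poly_has_derivative P D t \<longleftrightarrow>
     (\<forall>i. ((\<lambda>s. coeff (P s) i) has_vector_derivative coeff D i) (at t))"

lemma coeff_poly_has_derivative_0:
  assumes "poly_has_derivative P D t" "\<And>s. coeff (P s) i = c"
  shows "coeff D i = 0"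
  using assms by (auto simp: poly_has_derivative_def intro: has_vector_derivative_const_imp_0 dest!: spec[of _ i])

text \<open>Product rule on the moment expansion: differentiating the coefficients gives the term
  with \<open>D\<close>, while differentiating the weight multiplies by -(cnj q * z + q / z), which
  shifts the index to k - 1 and k + 1. The uniform degree bound keeps the sum over the same indices
  for all s.\<close>

lemma circle_ip_has_derivative:
  assumes circ: "circle_measure M" and D: "poly_has_derivative P D t" and deg: "\<And>s. degree (P s) \<le> n"
  shows "((\<lambda>s. circle_ip (exp_tilt M q s) (P s) k) has_vector_derivative
    circle_ip (exp_tilt M q t) D k - (cnj q * circle_ip (exp_tilt M q t) (P t) (k - 1)
      + q * circle_ip (exp_tilt M q t) (P t) (k + 1))) (at t)"
proof -
  let ?c = "\<lambda>s j. LINT z|exp_tilt M q s. z powi j"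
  note circ_t = circle_measure_exp_tilt[OF circ]
  have c: "((\<lambda>s. ?c s j) has_vector_derivative - (cnj q * ?c t (j + 1) + q * ?c t (j - 1))) (at t)" for j
  proof -
    have "(LINT z|exp_tilt M q t. (cnj q * z + q / z) * z powi j)
        = (LINT z|exp_tilt M q t. cnj q * z powi (j + 1) + q * z powi (j - 1))"
    proof (rule Bochner_Integration.integral_cong)
      fix z assume "z \<in> space (exp_tilt M q t)"
      then have "z \<noteq> 0" using space_circle_measure[OF circ_t] by auto
      then show "(cnj q * z + q / z) * z powi j = cnj q * z powi (j + 1) + q * z powi (j - 1)"
        by (simp add: power_int_add power_int_diff field_simps)
    qed simp
    also have "\<dots> = cnj q * ?c t (j + 1) + q * ?c t (j - 1)"
      by (subst Bochner_Integration.integral_add)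
        (auto intro!: integrable_mult_right integrable_circle[OF circ_t, OF continuous_on_powi_circle])
    finally show ?thesis
      using has_vector_derivative_exp_tilt[OF circ continuous_on_powi_circle] by metis
  qed
  have degD: "degree D \<le> n"
    by (intro degree_le allI impI coeff_poly_has_derivative_0[OF D])
      (simp add: coeff_eq_0 le_less_trans[OF deg])
  have "((\<lambda>s. \<Sum>i\<le>n. coeff (P s) i * ?c s (int i - k)) has_vector_derivative
      (\<Sum>i\<le>n. coeff (P t) i * - (cnj q * ?c t (int i - k + 1) + q * ?c t (int i - k - 1))
        + coeff D i * ?c t (int i - k))) (at t)"
    by (intro has_vector_derivative_sum has_vector_derivative_mult c)
      (use D in \<open>auto simp: poly_has_derivative_def\<close>)
  also have "(\<Sum>i\<le>n. coeff (P t) i * - (cnj q * ?c t (int i - k + 1) + q * ?c t (int i - k - 1))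
        + coeff D i * ?c t (int i - k))
      = (\<Sum>i\<le>n. coeff D i * ?c t (int i - k))
        - (cnj q * (\<Sum>i\<le>n. coeff (P t) i * ?c t (int i - (k - 1)))
        + q * (\<Sum>i\<le>n. coeff (P t) i * ?c t (int i - (k + 1))))"
    by (simp add: sum_distrib_left sum.distrib[symmetric] sum_subtractf[symmetric] algebra_simps)
  finally show ?thesis
    by (simp add: circle_ip_moments[OF circ_t deg] circle_ip_moments[OF circ_t degD])
qed

text \<open>Induction along the recursion, whose only division is by a norm that is nonzero for
  every s.\<close>

lemma szego_poly_differentiable:
  assumes "nondegenerate M"
  shows "\<exists>D. poly_has_derivative (\<lambda>s. szego_poly (exp_tilt M q s) n) D t"
proof (induction n)
  case 0
  show ?case
    by (rule exI[of _ 0]) (simp add: poly_has_derivative_def)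
next
  case (Suc n)
  then obtain D where D: "poly_has_derivative (\<lambda>s. szego_poly (exp_tilt M q s) n) D t" by blast
  let ?P = "\<lambda>s. szego_poly (exp_tilt M q s)"
  let ?b = "\<lambda>s. szego_coeff (exp_tilt M q s) n"
  note circ = nondegenerate_circle[OF assms]
  have "(\<lambda>s. circle_ip (exp_tilt M q s) (?P s n) k) differentiable at t" for k
    by (rule differentiableI_vector, rule circle_ip_has_derivative[OF circ D, of n]) simp
  then have "?b differentiable at t"
    unfolding szego_coeff_def szego_norm_def
    using szego_norm_nz[OF nondegenerate_exp_tilt[OF assms]]
    by (intro differentiable_divide) (auto simp: szego_norm_def)
  then obtain b' where b': "(?b has_vector_derivative b') (at t)"
    unfolding vector_derivative_works by blast
  have D_i: "((\<lambda>s. coeff (?P s n) i) has_vector_derivative coeff D i) (at t)" for i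
    using D by (simp add: poly_has_derivative_def)
  have rev: "\<exists>d. ((\<lambda>s. coeff (rev_poly (?P s n)) i) has_vector_derivative d) (at t)" for i
    unfolding coeff_rev_poly degree_szego_poly
    by (cases "i \<le> n") (auto intro!: exI derivative_intros D_i)
  have pCons: "\<exists>d. ((\<lambda>s. coeff (pCons 0 (?P s n)) i) has_vector_derivative d) (at t)" for i
    by (cases i) (auto intro!: exI derivative_intros D_i)
  have "\<exists>d. ((\<lambda>s. coeff (?P s (Suc n)) i) has_vector_derivative d) (at t)" for i
  proof -
    obtain d1 d2 where d: "((\<lambda>s. coeff (rev_poly (?P s n)) i) has_vector_derivative d1) (at t)"
      "((\<lambda>s. coeff (pCons 0 (?P s n)) i) has_vector_derivative d2) (at t)"
      using rev pCons by metis
    show ?thesis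
      unfolding szego_poly_Suc coeff_diff coeff_smult
      using has_vector_derivative_diff[OF d(2) has_vector_derivative_mult[OF b' d(1)]] by blast
  qed
  then obtain d where d: "\<And>i. ((\<lambda>s. coeff (?P s (Suc n)) i) has_vector_derivative d i) (at t)"
    by metis
  \<comment> \<open>The derivatives obtained coefficient by coefficient must vanish beyond some
    index before they can be assembled into a polynomial.\<close>
  have "d i = 0" if "i > Suc n" for i
  proof -
    have "coeff (?P s (Suc n)) i = 0" for s
      using that by (intro coeff_eq_0) simp
    then show ?thesis
      using d[of i] by (auto dest: has_vector_derivative_const_imp_0)
  qed
  then have "coeff (Abs_poly d) = d"
    by (rule coeff_Abs_poly)
  then show ?case
    using d by (auto simp: poly_has_derivative_def intro!: exI[of _ "Abs_poly d"])
qed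

section \<open>The derivative of Phi_(m+1) in closed form\<close>

text \<open>Among the powers 1, ..., z^m, the polynomial Phi_m pairs nontrivially only with z^m and
  its reversal only with 1. The right-hand side is the combination whose pairings equal those of the
  derivative, and both sides have degree at most m.\<close>

lemma szego_poly_has_derivative:
  fixes q :: complex and t :: real
  assumes "nondegenerate M"
  defines "N \<equiv> exp_tilt M q t"
  shows "poly_has_derivative (\<lambda>s. szego_poly (exp_tilt M q s) (Suc m))
    (smult (1 - (cmod (szego_coeff N m))\<^sup>2)
      (smult (cnj q * szego_coeff N (Suc m)) (rev_poly (szego_poly N m)) + smult q (szego_poly N m))) t"
    (is "poly_has_derivative ?P ?R t")
proof -
  note nondeg = nondegenerate_exp_tilt[OF assms(1), of q t, folded N_def]
  note circ = nondegenerate_circle[OF nondeg]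
  obtain D where D: "poly_has_derivative ?P D t"
    using szego_poly_differentiable[OF assms(1)] by blast
  \<comment> \<open>The leading coefficient is constantly 1, so differentiation lowers the
    degree.\<close>
  have degD: "degree D \<le> m"
  proof (intro degree_le allI impI)
    fix i assume "m < i"
    then have "coeff (?P s) i = (if i = Suc m then 1 else 0)" for s
      by (simp add: coeff_eq_0)
    then show "coeff D i = 0"
      by (rule coeff_poly_has_derivative_0[OF D])
  qed
  have degR: "degree ?R \<le> m"
    using degree_rev_poly[of "szego_poly N m"]
    by (intro degree_smult_le[THEN order_trans] degree_add_le) auto
  \<comment> \<open>The orthogonality relation holds for every s, so its t-derivative vanishes; this
    expresses the pairings of \<open>D\<close> through those of Phi_(m+1).\<close>
  have ipD: "circle_ip N D k = cnj q * circle_ip N (szego_poly N (Suc m)) (k - 1)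
      + q * circle_ip N (szego_poly N (Suc m)) (k + 1)" if "0 \<le> k" "k \<le> int m" for k
  proof -
    have "((\<lambda>s. circle_ip (exp_tilt M q s) (?P s) k) has_vector_derivative
        circle_ip N D k - (cnj q * circle_ip N (szego_poly N (Suc m)) (k - 1)
          + q * circle_ip N (szego_poly N (Suc m)) (k + 1))) (at t)"
      unfolding N_def
      by (rule circle_ip_has_derivative[OF nondegenerate_circle[OF assms(1)] D, of "Suc m"]) simp
    moreover have "circle_ip (exp_tilt M q s) (?P s) k = 0" for s
      using that by (intro szego_poly_orthogonal nondegenerate_exp_tilt assms(1)) auto
    ultimately show ?thesis
      by (auto dest: has_vector_derivative_const_imp_0)
  qed
  have "D - ?R = 0"
  proof (rule nondegenerate_orthogonal_imp_0[OF nondeg])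
    fix k assume "k \<le> degree (D - ?R)"
    then have k: "k \<le> m"
      using degree_diff_le[OF degD degR] by simp
    \<comment> \<open>Index k - 1 leaves the range of orthogonality only at k = 0, and k + 1 only at
      k = m. For m = 0 both happen at once, so the two contributions are kept as separate
      conditionals.\<close>
    have minus: "circle_ip N (szego_poly N (Suc m)) (int k - 1)
        = (if k = 0 then szego_coeff N (Suc m) * szego_norm N (Suc m) else 0)"
      using k circle_ip_szego_poly_minus_1[OF nondeg] szego_poly_orthogonal[OF nondeg] by simp
    have plus: "circle_ip N (szego_poly N (Suc m)) (int k + 1)
        = (if k = m then szego_norm N (Suc m) else 0)"
      using k szego_poly_orthogonal[OF nondeg] by (simp add: szego_norm_def add.commute)
    have low: "circle_ip N (szego_poly N m) (int k) = (if k = m then szego_norm N m else 0)"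
      using k szego_poly_orthogonal[OF nondeg] by (simp add: szego_norm_def)
    have rev: "circle_ip N (rev_poly (szego_poly N m)) (int k) = (if k = 0 then szego_norm N m else 0)"
      using k szego_poly_orthogonal[OF nondeg] cnj_szego_norm[OF nondeg, of m]
      by (simp add: circle_ip_rev_poly[OF circ] szego_norm_def)
    have "circle_ip N D (int k)
        = cnj q * (if k = 0 then szego_coeff N (Suc m) * szego_norm N (Suc m) else 0)
          + q * (if k = m then szego_norm N (Suc m) else 0)"
      using k by (simp only: ipD minus plus of_nat_0_le_iff of_nat_le_iff)
    then show "circle_ip N (D - ?R) (int k) = 0"
      by (simp add: circle_ip_diff[OF circ] circle_ip_add[OF circ] circle_ip_smult[OF circ]
          low rev szego_norm_Suc[OF nondeg] algebra_simps)
  qed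
  then show ?thesis using D by simp
qed

section \<open>The evolution equation of the Verblunsky coefficients\<close>

theorem theorem6:
  fixes \<mu> :: "complex measure" and q :: complex and a :: "nat \<Rightarrow> real \<Rightarrow> complex"
  assumes "circle_measure \<mu>"
    and "infinite (measure_support \<mu>)"
    and "\<And>n t. a n t = verblunsky (exp_tilt \<mu> q t) n"
    and "\<And>n t. a n t \<noteq> 0"
  shows "\<forall>n\<ge>1. \<forall>t.
    (a n has_vector_derivative
      (1 - of_real ((cmod (a n t))\<^sup>2)) * (cnj q * a (n - 1) t - q * a (n + 1) t)) (at t)"
proof (intro allI impI)
  fix n :: nat and t :: real
  assume "1 \<le> n"
  then obtain m where n: "n = Suc m" by (cases n) auto
  have nondeg: "nondegenerate \<mu>"
    using assms(1,2) by (rule nondegenerate_infinite_support)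
  let ?b = "\<lambda>k s. szego_coeff (exp_tilt \<mu> q s) k"
  have a: "a k = (\<lambda>s. cnj (?b k s))" for k
    using assms(3) verblunsky_eq[OF nondegenerate_exp_tilt[OF nondeg]] by auto
  \<comment> \<open>Constant coefficients: the reversal of Phi_n contributes 1 because Phi_n is
    monic, and Phi_n contributes \<open>- ?b m\<close>, where n \<ge> 1 is used.\<close>
  have "((\<lambda>s. coeff (szego_poly (exp_tilt \<mu> q s) (Suc n)) 0) has_vector_derivative
      (1 - (cmod (?b n t))\<^sup>2) * (cnj q * ?b (Suc n) t - q * ?b m t)) (at t)"
    using szego_poly_has_derivative[OF nondeg, of q n t, unfolded poly_has_derivative_def, rule_format, of 0]
    by (simp add: coeff_rev_poly n coeff_0_szego_poly_Suc)
  then have "((\<lambda>s. cnj (- ?b n s)) has_vector_derivative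
      cnj ((1 - (cmod (?b n t))\<^sup>2) * (cnj q * ?b (Suc n) t - q * ?b m t))) (at t)"
    unfolding coeff_0_szego_poly_Suc by (rule has_vector_derivative_cnj)
  \<comment> \<open>Conjugation has exchanged \<open>q\<close> with \<open>cnj q\<close> and
    \<open>?b\<close> with \<open>a\<close>; the sign comes from the constant coefficient of
    Phi_(n+1) being \<open>- ?b n\<close>.\<close>
  from has_vector_derivative_minus[OF this]
  show "(a n has_vector_derivative
      (1 - of_real ((cmod (a n t))\<^sup>2)) * (cnj q * a (n - 1) t - q * a (n + 1) t)) (at t)"
    unfolding a by (simp add: n algebra_simps)
qed

end
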